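(* Let $G$ be an entwined graph such that all odd cycles in $G$ are edge disjoint, and let $r$ be the number of odd cycles in $G$. Then $G$ admits a weak IASI if and only if it has at least $r$ mono-indexed edges.
   Context: All graphs are simple and finite, with no isolated vertices; $\mathbb{N}_0$ denotes the set of non-negative integers. For $A,B\subseteq\mathbb{N}_0$, $A+B=\{a+b: a\in A, b\in B\}$. An integer additive set-indexer (IASI) of a graph $G$ is an injective function $f:V(G)\to 2^{\mathbb{N}_0}$ such that the induced function $g_f:E(G)\to 2^{\mathbb{N}_0}$, $g_f(uv)=f(u)+f(v)$, is also injective. An IASI $f$ is a weak IASI if $|g_f(uv)|=\max(|f(u)|,|f(v)|)$ for every edge $uv$. An element (vertex or edge) whose set-label has cardinality $1$ is called mono-indexed. An entwined graph is a graph that is a union of cycles in which every path appears in at most two cycles and every cycle is attached (shares a common path) with at most two other cycles, so that common paths are shared by exactly two cycles.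
   Formalization: Set-labels are required to be finite, since a triangle labelled with infinite sets can be a weak IASI with no mono-indexed edge; necessity is stated for every weak IASI, and the converse asks only that some IASI has at least r mono-indexed edges. *)

theory Defs
  imports Complex_Main "HOL-Library.Set_Algebras"
begin

definition simple_graph :: "'a set \<Rightarrow> 'a set set \<Rightarrow> bool" where
  "simple_graph V E \<longleftrightarrow> finite V \<and> (\<forall>e\<in>E. e \<subseteq> V \<and> card e = 2)"

definition no_isolated_vertices :: "'a set \<Rightarrow> 'a set set \<Rightarrow> bool" where
  "no_isolated_vertices V E \<longleftrightarrow> (\<forall>v\<in>V. \<exists>e\<in>E. v \<in> e)"

text \<open>Paths and cycles are subgraphs. A path with at least one edge and a cycle are determined by
  their edge sets, so both are represented by edge sets; the vertex set of a cycle \<open>C\<close>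
  is \<open>\<Union>C\<close>.\<close>

definition path_edges :: "'a list \<Rightarrow> 'a set set" where
  "path_edges xs = {{xs ! i, xs ! Suc i} | i. Suc i < length xs}"

definition cycle_edges :: "'a list \<Rightarrow> 'a set set" where
  "cycle_edges xs = insert {last xs, hd xs} (path_edges xs)"

definition paths :: "'a set set \<Rightarrow> 'a set set set" where
  "paths E = {path_edges xs | xs. distinct xs \<and> 2 \<le> length xs \<and> path_edges xs \<subseteq> E}"

definition cycles :: "'a set set \<Rightarrow> 'a set set set" where
  "cycles E = {cycle_edges xs | xs. distinct xs \<and> 3 \<le> length xs \<and> cycle_edges xs \<subseteq> E}"

definition odd_cycles :: "'a set set \<Rightarrow> 'a set set set" where
  "odd_cycles E = {C \<in> cycles E. odd (card C)}"

definition attached :: "'a set set \<Rightarrow> 'a set set \<Rightarrow> bool" where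
  "attached C D \<longleftrightarrow> (\<exists>P. P \<in> paths C \<and> P \<in> paths D)"

text \<open>The cycles counted here are those of the family \<open>\<C>\<close> whose union is the graph. Two cycles
  of \<open>\<C>\<close> sharing a path may create further cycles in the graph, which need not belong to \<open>\<C>\<close>;
  taking \<open>\<C>\<close> to be the set of all cycles of the graph is allowed (\<open>entwinedI_all_cycles\<close>).\<close>

definition entwined :: "'a set \<Rightarrow> 'a set set \<Rightarrow> bool" where
  "entwined V E \<longleftrightarrow>
     (\<exists>\<C> \<subseteq> cycles E.
        E = \<Union>\<C> \<and> V = (\<Union>C\<in>\<C>. \<Union>C) \<and>
        (\<forall>P\<in>paths E. card {C \<in> \<C>. P \<subseteq> C} \<le> 2) \<and>
        (\<forall>C\<in>\<C>. card {D \<in> \<C>. D \<noteq> C \<and> attached C D} \<le> 2) \<and>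
        (\<forall>C\<in>\<C>. \<forall>D\<in>\<C>. C \<noteq> D \<longrightarrow> (\<forall>P. P \<in> paths C \<and> P \<in> paths D \<longrightarrow> card {F \<in> \<C>. P \<subseteq> F} = 2)))"

lemma entwinedI_all_cycles:
  assumes G: "simple_graph V E" and E: "E = \<Union>(cycles E)" and V: "V = \<Union>E"
    and path: "\<And>P. P \<in> paths E \<Longrightarrow> card {C \<in> cycles E. P \<subseteq> C} \<le> 2"
    and att: "\<And>C. C \<in> cycles E \<Longrightarrow> card {D \<in> cycles E. D \<noteq> C \<and> attached C D} \<le> 2"
  shows "entwined V E"
proof -
  have "E \<subseteq> Pow V" "finite V" using G by (auto simp: simple_graph_def)
  then have "finite E" by (meson finite_Pow_iff finite_subset)
  moreover have "cycles E \<subseteq> Pow E" by (auto simp: cycles_def)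
  ultimately have fin: "finite (cycles E)" by (meson finite_Pow_iff finite_subset)
  have "card {F \<in> cycles E. P \<subseteq> F} = 2"
    if "C \<in> cycles E" "D \<in> cycles E" "C \<noteq> D" "P \<in> paths C" "P \<in> paths D" for C D P
  proof -
    have "P \<subseteq> C" "P \<subseteq> D" using that by (auto simp: paths_def)
    then have "card {C, D} \<le> card {F \<in> cycles E. P \<subseteq> F}"
      using that fin by (intro card_mono) auto
    moreover have "C \<subseteq> E" using that(1) by (auto simp: cycles_def)
    then have "P \<in> paths E" using that(4) unfolding paths_def by blast
    ultimately show ?thesis using path[of P] \<open>C \<noteq> D\<close> by simp
  qed
  moreover have "V = (\<Union>C\<in>cycles E. \<Union>C)"
    unfolding V by (subst E) blast
  ultimately show ?thesis unfolding entwined_def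
    by (intro exI[of _ "cycles E"] conjI ballI allI impI order_refl E path att) auto
qed

text \<open>The sum is taken in the commutative monoid of sets of natural numbers under
  \<open>A + B = {a + b | a b. a \<in> A \<and> b \<in> B}\<close>; see \<open>edge_label_doubleton\<close>.\<close>

definition edge_label :: "('a \<Rightarrow> nat set) \<Rightarrow> 'a set \<Rightarrow> nat set" where
  "edge_label f e = (\<Sum>v\<in>e. f v)"

lemma edge_label_doubleton:
  "u \<noteq> v \<Longrightarrow> edge_label f {u, v} = {a + b | a b. a \<in> f u \<and> b \<in> f v}"
  by (auto simp: edge_label_def set_plus_def)

text \<open>Set-labels are finite, so that their cardinalities are natural numbers. With infinite
  labels allowed, a triangle could be labelled weakly without any mono-indexed edge.\<close>

definition IASI :: "'a set \<Rightarrow> 'a set set \<Rightarrow> ('a \<Rightarrow> nat set) \<Rightarrow> bool" where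
  "IASI V E f \<longleftrightarrow>
     (\<forall>v\<in>V. finite (f v)) \<and> inj_on f V \<and> inj_on (edge_label f) E"

definition weak_IASI :: "'a set \<Rightarrow> 'a set set \<Rightarrow> ('a \<Rightarrow> nat set) \<Rightarrow> bool" where
  "weak_IASI V E f \<longleftrightarrow> IASI V E f \<and>
     (\<forall>u v. {u, v} \<in> E \<longrightarrow> card (edge_label f {u, v}) = max (card (f u)) (card (f v)))"

definition mono_indexed_edges :: "'a set set \<Rightarrow> ('a \<Rightarrow> nat set) \<Rightarrow> 'a set set" where
  "mono_indexed_edges E f = {e \<in> E. card (edge_label f e) = 1}"

end

theory Submission
  imports Defs "HOL-Library.Nat_Bijection"
begin

text \<open>Labelling the vertices by singletons of distinct powers of two always gives a weak IASI, so
  the content is the lower bound. Two finite sets of at least two naturals each have a sumset larger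
  than either of them, so under a weak IASI every edge has a mono-indexed end vertex. A cycle without
  a mono-indexed edge would thus be properly 2-coloured by \<open>card (f v) = 1\<close> and hence even. So
  every odd cycle contains a mono-indexed edge, and disjoint odd cycles contain distinct ones.\<close>

lemma edge_label_pair: "u \<noteq> v \<Longrightarrow> edge_label f {u, v} = f u + f v"
  by (simp add: edge_label_def)

text \<open>The translate of \<open>A\<close> by \<open>Min B\<close> already has
  \<open>card A\<close> elements. Since \<open>Min B < Max B\<close>, all of them lie below
  \<open>Max A + Max B\<close>, which is one further element of the sumset.\<close>

lemma card_less_card_sumset:
  fixes A B :: "nat set"
  assumes "finite A" "finite B" "A \<noteq> {}" "2 \<le> card B"
  shows "card A < card (A + B)"
proof -
  have "B \<noteq> {}" using assms(4) by auto
  have "Min B \<noteq> Max B"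
  proof
    assume "Min B = Max B"
    then have "B \<subseteq> {Min B}"
      using \<open>finite B\<close> by (metis Max_ge Min_le antisym singletonI subsetI)
    then have "card B \<le> 1" using card_mono[of "{Min B}" B] by simp
    then show False using assms(4) by simp
  qed
  then have less: "Min B < Max B"
    using \<open>finite B\<close> \<open>B \<noteq> {}\<close> by (simp add: le_neq_implies_less)
  let ?S = "(\<lambda>a. a + Min B) ` A"
  have "a + Min B < Max A + Max B" if "a \<in> A" for a
    using Max_ge[OF \<open>finite A\<close> that] less by linarith
  then have "Max A + Max B \<notin> ?S" by fastforce
  moreover have "card ?S = card A" by (intro card_image) (auto simp: inj_on_def)
  ultimately have "card (insert (Max A + Max B) ?S) = Suc (card A)"
    using \<open>finite A\<close> by simp
  moreover have "insert (Max A + Max B) ?S \<subseteq> A + B"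
    using Max_in[of A] Max_in[of B] Min_in[of B] assms(1-3) \<open>B \<noteq> {}\<close>
    by (auto intro!: set_plus_intro simp del: Max_in Min_in)
  moreover have "finite (A + B)" using assms by (simp add: finite_set_plus)
  ultimately show ?thesis by (metis card_mono Suc_le_eq)
qed

lemma card_sumset_eq_max_imp_singleton:
  fixes A B :: "nat set"
  assumes "finite A" "finite B" "A \<noteq> B" "card (A + B) = max (card A) (card B)"
  shows "card A = 1 \<or> card B = 1"
proof -
  \<comment> \<open>If either set were empty, the sumset would be empty and the maximum 0, so both
    sets would be empty, against \<open>A \<noteq> B\<close>.\<close>
  have "A \<noteq> {}" "B \<noteq> {}"
    using assms by (auto simp: set_plus_def max_def split: if_splits)
  then have pos: "card A > 0" "card B > 0" using assms by (simp_all add: card_gt_0_iff)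
  have "\<not> (2 \<le> card A \<and> 2 \<le> card B)"
  proof
    assume "2 \<le> card A \<and> 2 \<le> card B"
    then have "card A < card (A + B)" "card B < card (B + A)"
      using assms(1,2) \<open>A \<noteq> {}\<close> \<open>B \<noteq> {}\<close> by (simp_all add: card_less_card_sumset)
    then show False using assms(4) by (simp add: add.commute max_def split: if_splits)
  qed
  then show ?thesis using pos by linarith
qed

lemma path_edges_conv_image:
  "path_edges xs = (\<lambda>i. {xs ! i, xs ! Suc i}) ` {..<length xs - 1}"
  by (auto simp: path_edges_def)

text \<open>Different positions give different edges: a crossed coincidence of positions
  \<open>i\<close> and \<open>j\<close> would need both \<open>i = Suc j\<close> and
  \<open>Suc i = j\<close>.\<close>

lemma card_path_edges:
  assumes "distinct xs"
  shows "card (path_edges xs) = length xs - 1"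
proof -
  have "inj_on (\<lambda>i. {xs ! i, xs ! Suc i}) {..<length xs - 1}"
    using assms by (auto simp: inj_on_def doubleton_eq_iff nth_eq_iff_index_eq)
  then show ?thesis by (simp add: path_edges_conv_image card_image)
qed

lemma card_cycle_edges:
  assumes "distinct xs" "3 \<le> length xs"
  shows "card (cycle_edges xs) = length xs"
proof -
  have ne: "xs \<noteq> []" using assms by auto
  have "{last xs, hd xs} \<notin> path_edges xs"
  proof
    assume "{last xs, hd xs} \<in> path_edges xs"
    then obtain i where i: "Suc i < length xs"
        "{xs ! (length xs - 1), xs ! 0} = {xs ! i, xs ! Suc i}"
      using ne by (auto simp: path_edges_def last_conv_nth hd_conv_nth)
    \<comment> \<open>The first case is absurd and the second forces length 2. This is where length
      at least 3 keeps the closing edge new.\<close>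
    then have "length xs - 1 = i \<and> 0 = Suc i \<or> length xs - 1 = Suc i \<and> 0 = i"
      using assms ne by (auto simp: doubleton_eq_iff nth_eq_iff_index_eq)
    then show False using assms i by auto
  qed
  moreover have "finite (path_edges xs)" by (simp add: path_edges_conv_image)
  ultimately show ?thesis
    using assms by (simp add: cycle_edges_def card_path_edges)
qed

text \<open>\<open>P\<close> is read as a 2-colouring of the vertices. It is left arbitrary here and
  later becomes the property of being mono-indexed.\<close>

lemma odd_cycle_not_two_colourable:
  assumes "C \<in> odd_cycles E"
  obtains u v where "{u, v} \<in> C" "P u \<longleftrightarrow> P v"
proof (rule ccontr)
  assume "\<not> thesis"
  then have alt: "\<And>u v. {u, v} \<in> C \<Longrightarrow> P u \<longleftrightarrow> \<not> P v" using that by blast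
  obtain xs where xs: "distinct xs" "3 \<le> length xs" "C = cycle_edges xs"
    using assms by (auto simp: odd_cycles_def cycles_def)
  have ne: "xs \<noteq> []" using xs by auto
  have odd: "odd (length xs)"
    using assms xs by (simp add: odd_cycles_def card_cycle_edges)
  \<comment> \<open>Colours alternate along the path, so the parity of the position decides the
    colour.\<close>
  have "P (xs ! i) \<longleftrightarrow> (P (xs ! 0) \<longleftrightarrow> even i)" if "i < length xs" for i
    using that
  proof (induction i)
    case (Suc i)
    then have "{xs ! i, xs ! Suc i} \<in> C"
      by (auto simp: xs cycle_edges_def path_edges_def)
    from alt[OF this] Suc show ?case by auto
  qed simp
  \<comment> \<open>The last position is even because the length is odd, so the closing edge joins
    two vertices of equal colour.\<close>
  from this[of "length xs - 1"] have "P (last xs) \<longleftrightarrow> P (hd xs)"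
    using ne odd by (simp add: last_conv_nth hd_conv_nth)
  moreover have "{last xs, hd xs} \<in> C" by (simp add: xs cycle_edges_def)
  ultimately show False using alt by blast
qed

lemma odd_cycle_has_mono_indexed_edge:
  assumes G: "simple_graph V E" and f: "weak_IASI V E f" and C: "C \<in> odd_cycles E"
  shows "\<exists>e\<in>C. e \<in> mono_indexed_edges E f"
proof -
  obtain u v where uv: "{u, v} \<in> C" "card (f u) = 1 \<longleftrightarrow> card (f v) = 1"
    using odd_cycle_not_two_colourable[OF C, of "\<lambda>v. card (f v) = 1"] by blast
  have E: "{u, v} \<in> E" using uv C by (auto simp: odd_cycles_def cycles_def)
  then have "card {u, v} = 2" "u \<in> V" "v \<in> V" using G by (auto simp: simple_graph_def)
  then have "u \<noteq> v" by auto
  have fin: "finite (f u)" "finite (f v)" and "f u \<noteq> f v"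
    using f \<open>u \<in> V\<close> \<open>v \<in> V\<close> \<open>u \<noteq> v\<close> by (auto simp: weak_IASI_def IASI_def inj_on_def)
  have label: "card (edge_label f {u, v}) = max (card (f u)) (card (f v))"
    using f E by (auto simp: weak_IASI_def)
  then have "card (f u) = 1 \<or> card (f v) = 1"
    using fin \<open>f u \<noteq> f v\<close> \<open>u \<noteq> v\<close>
    by (intro card_sumset_eq_max_imp_singleton) (simp_all add: edge_label_pair)
  \<comment> \<open>The ends agree on being mono-indexed and one of them is, so both cardinalities
    are 1 and so is their maximum.\<close>
  with label uv E show ?thesis by (auto simp: mono_indexed_edges_def)
qed

text \<open>Choosing an element of \<open>M\<close> in each member of the family is injective, since
  disjoint members cannot share the chosen element.\<close>

lemma card_le_of_disjoint_hitting:
  assumes "finite M" "pairwise disjnt \<C>" "\<And>C. C \<in> \<C> \<Longrightarrow> \<exists>e\<in>C. e \<in> M"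
  shows "card \<C> \<le> card M"
proof -
  obtain g where g: "\<And>C. C \<in> \<C> \<Longrightarrow> g C \<in> C \<and> g C \<in> M"
    using assms(3) by metis
  have "inj_on g \<C>"
    by (rule inj_onI) (metis g assms(2) pairwiseD disjnt_iff)
  then show ?thesis using g assms(1) by (intro card_inj_on_le) auto
qed

lemma finite_edges: "simple_graph V E \<Longrightarrow> finite E"
  by (rule finite_subset[of _ "Pow V"]) (auto simp: simple_graph_def)

lemma weak_IASI_exists:
  assumes G: "simple_graph V E"
  shows "\<exists>f. weak_IASI V E f"
proof -
  have "finite V" using G by (simp add: simple_graph_def)
  then obtain h :: "'a \<Rightarrow> nat" where h: "inj_on h V"
    using finite_imp_inj_to_nat_seg by metis
  define f where "f v = {(2::nat) ^ h v}" for v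
  have edge: "e \<subseteq> V \<and> card e = 2" if "e \<in> E" for e
    using G that by (simp add: simple_graph_def)
  have label: "edge_label f e = {set_encode (h ` e)}" if e: "e \<in> E" for e
  proof -
    obtain u v where "e = {u, v}" "u \<noteq> v" "u \<in> V" "v \<in> V"
      using edge[OF e] by (auto simp: card_2_iff)
    moreover from this have "h u \<noteq> h v" using h by (auto simp: inj_on_def)
    ultimately show ?thesis
      by (simp add: edge_label_pair f_def set_encode_def set_plus_def)
  qed
  have "inj_on (edge_label f) E"
  proof (rule inj_onI)
    fix d e assume de: "d \<in> E" "e \<in> E" "edge_label f d = edge_label f e"
    \<comment> \<open>\<open>set_encode\<close> is injective only on finite sets.\<close>
    have "finite d" "finite e"
      using de(1,2) edge \<open>finite V\<close> finite_subset by blast+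
    moreover have "set_encode (h ` d) = set_encode (h ` e)"
      using de(3) unfolding label[OF de(1)] label[OF de(2)] by simp
    ultimately have "h ` d = h ` e" by (simp add: set_encode_eq)
    then show "d = e" using inj_on_image_eq_iff[OF h] edge de(1,2) by blast
  qed
  moreover have "inj_on f V" using h by (auto simp: inj_on_def f_def)
  moreover have "card (edge_label f {u, v}) = max (card (f u)) (card (f v))"
    if "{u, v} \<in> E" for u v
    using label[OF that] by (simp add: f_def)
  ultimately have "weak_IASI V E f" by (simp add: weak_IASI_def IASI_def f_def)
  then show ?thesis by blast
qed

theorem theorem4p3:
  fixes V :: "'a set" and E :: "'a set set" and r :: nat
  assumes "simple_graph V E" and "no_isolated_vertices V E"
    and "entwined V E"
    and "pairwise disjnt (odd_cycles E)"
    and "r = card (odd_cycles E)"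
  shows "((\<exists>f. weak_IASI V E f) \<longleftrightarrow>
            (\<exists>f. IASI V E f \<and> r \<le> card (mono_indexed_edges E f)))
       \<and> (\<forall>f. weak_IASI V E f \<longrightarrow> r \<le> card (mono_indexed_edges E f))"
proof -
  have "r \<le> card (mono_indexed_edges E f)" if "weak_IASI V E f" for f
  proof -
    have "finite (mono_indexed_edges E f)"
      using finite_edges[OF assms(1)] by (simp add: mono_indexed_edges_def)
    then show ?thesis
      unfolding assms(5)
      using assms(4) odd_cycle_has_mono_indexed_edge[OF assms(1) that]
      by (rule card_le_of_disjoint_hitting)
  qed
  \<comment> \<open>A weak IASI exists, and by the bound it also witnesses the right-hand side, so
    both sides of the equivalence hold.\<close>
  then show ?thesis
    using weak_IASI_exists[OF assms(1)] unfolding weak_IASI_def by blast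
qed

end
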